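(* Let $n, k, s$ be positive integers with $n\ge 3k^2 s$, and let $H$ be a $k$-uniform hypergraph on $n$ vertices. If the degree of every vertex of $H$ is strictly greater than $\binom{n-1}{k-1}-\binom{n-s}{k-1}$, then $H$ contains a matching of $s$ disjoint edges.
   Context: A $k$-uniform hypergraph $H$ consists of a finite vertex set $V(H)$ and an edge set $E(H)$, which is a set of $k$-element subsets of $V(H)$. The degree of a vertex is the number of edges containing it. A matching in $H$ is a collection of pairwise vertex-disjoint edges of $H$. *)

theory Defs
  imports Complex_Main "HOL-Library.Disjoint_Sets"
begin

definition uniform_hypergraph :: "nat \<Rightarrow> 'a set \<Rightarrow> 'a set set \<Rightarrow> bool" where
  "uniform_hypergraph k V E \<longleftrightarrow> finite V \<and> (\<forall>e\<in>E. e \<subseteq> V \<and> card e = k)"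

definition degree :: "'a set set \<Rightarrow> 'a \<Rightarrow> nat" where
  "degree E v = card {e \<in> E. v \<in> e}"

definition matching :: "'a set set \<Rightarrow> 'a set set \<Rightarrow> bool" where
  "matching E M \<longleftrightarrow> M \<subseteq> E \<and> disjoint M"

end

theory Submission
  imports Defs "HOL-Combinatorics.Transposition"
begin

text \<open>
  Write \<open>C = (n - 2) choose (k - 2)\<close>, which bounds the number of edges through two given vertices.
  The proof is an induction on \<open>s\<close>; let \<open>s + 1\<close> be the size of the matching that is sought.

  If some vertex \<open>v\<close> has degree above \<open>k s C\<close>, then it can be deleted: the degree condition passes
  to the hypergraph without \<open>v\<close> exactly, by Pascal's rule, and the matching of size \<open>s\<close> found
  there covers only \<open>k s\<close> vertices, so that it misses some edge through \<open>v\<close>.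

  Otherwise all degrees are at most \<open>k s C\<close>. If \<open>s + 1\<close> vertices have degree above \<open>2 s C\<close>, then
  one edge through each of them can be chosen so that these edges are disjoint
  (\<open>matching_if_many_large_degrees\<close>). If there are at most \<open>s\<close> such vertices and no matching of
  size \<open>s + 1\<close>, then the at most \<open>k s\<close> vertices of a maximum matching meet every edge, and adding
  up their degrees gives at most \<open>(3 k - 2) s\<^sup>2 C\<close> edges. But the degree condition gives about
  \<open>n s C / k\<close> edges, which is more than that for \<open>n \<ge> 3 k\<^sup>2 (s + 1)\<close>
  (\<open>degree_condition_estimate\<close>). It is the constant 2 in \<open>2 s C\<close>, in place of the \<open>k\<close> that a
  greedy choice of edges would need, that makes a bound quadratic in \<open>k\<close> sufficient.

  This constant comes from a theorem of Huang, Loh and Sudakov on rainbow matchings,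
  \<open>rainbow_matching_if_large\<close>: if \<open>F\<^sub>1, \<dots>, F\<^sub>s\<close> are families of subsets of an \<open>n\<close>-set, the sets in
  \<open>F\<^sub>i\<close> have size \<open>k\<^sub>i \<ge> 1\<close>, \<open>k\<^sub>1 + \<dots> + k\<^sub>s \<le> n\<close>, and \<open>F\<^sub>i\<close> has more than
  \<open>(s - 1) ((n - 1) choose (k\<^sub>i - 1))\<close> members for each \<open>i\<close>, then there are pairwise disjoint
  \<open>e\<^sub>i \<in> F\<^sub>i\<close>. When \<open>k\<^sub>1 + \<dots> + k\<^sub>s = n\<close>, a random ordered partition into parts of these sizes
  works with positive probability, by the union bound. When the sum is smaller, induct on \<open>n\<close>: fix
  an element \<open>z\<close>; shifting \<open>z\<close> to other elements makes every family closed under replacing \<open>z\<close>.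
  By Pascal's rule, for each \<open>i\<close> the link or the deletion of \<open>z\<close> in \<open>F\<^sub>i\<close> is large again. The
  induction hypothesis yields disjoint sets in these, and there are enough unused elements to complete
  each set that was taken from a link by an element of its own.
\<close>

section \<open>Counting edges of uniform hypergraphs\<close>

lemma uniform_hypergraph_finite:
  assumes "uniform_hypergraph k V E"
  shows "finite V" "finite E" "\<And>e. e \<in> E \<Longrightarrow> finite e"
proof -
  show "finite V" using assms by (simp add: uniform_hypergraph_def)
  moreover have "E \<subseteq> Pow V" using assms by (auto simp: uniform_hypergraph_def)
  ultimately show "finite E" by (metis finite_Pow_iff finite_subset)
  show "\<And>e. e \<in> E \<Longrightarrow> finite e"
    using assms by (auto simp: uniform_hypergraph_def intro: finite_subset)
qed

lemma uniform_hypergraph_card_le: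
  assumes "uniform_hypergraph k V E"
  shows "card E \<le> card V choose k"
proof -
  have "E \<subseteq> {e. e \<subseteq> V \<and> card e = k}" using assms by (auto simp: uniform_hypergraph_def)
  moreover have "finite {e. e \<subseteq> V \<and> card e = k}"
    using uniform_hypergraph_finite[OF assms] by simp
  ultimately have "card E \<le> card {e. e \<subseteq> V \<and> card e = k}" by (rule card_mono[rotated])
  then show ?thesis using n_subsets uniform_hypergraph_finite(1)[OF assms] by metis
qed

lemma sum_degree:
  assumes "uniform_hypergraph k V E"
  shows "(\<Sum>v\<in>V. degree E v) = k * card E"
  unfolding degree_def
proof (rule sum_multicount)
  show "\<forall>e\<in>E. card {v \<in> V. v \<in> e} = k"
    using assms by (auto simp: uniform_hypergraph_def Int_absorb1 Collect_conj_eq)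
qed (use uniform_hypergraph_finite[OF assms] in auto)

lemma codegree_le:
  assumes E: "uniform_hypergraph k V E" and "u \<noteq> v"
  shows "card {e \<in> E. v \<in> e \<and> u \<in> e} \<le> (card V - 2) choose (k - 2)"
proof (cases "{e \<in> E. v \<in> e \<and> u \<in> e} = {}")
  case True
  then show ?thesis by (metis card.empty le0)
next
  case False
  note fin = uniform_hypergraph_finite[OF E]
  let ?P = "{e \<in> E. v \<in> e \<and> u \<in> e}"
  have uv: "{u, v} \<subseteq> V" using False E by (auto simp: uniform_hypergraph_def)
  have "uniform_hypergraph (k - 2) (V - {u, v}) ((\<lambda>e. e - {u, v}) ` ?P)"
    using E fin \<open>u \<noteq> v\<close> by (auto simp: uniform_hypergraph_def card_Diff_subset)
  then have "card ((\<lambda>e. e - {u, v}) ` ?P) \<le> card (V - {u, v}) choose (k - 2)"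
    by (rule uniform_hypergraph_card_le)
  moreover have "card ((\<lambda>e. e - {u, v}) ` ?P) = card ?P"
    by (rule card_image) (auto simp: inj_on_def)
  moreover have "card (V - {u, v}) = card V - 2"
    using uv \<open>u \<noteq> v\<close> by (simp add: card_Diff_subset)
  ultimately show ?thesis by simp
qed

lemma card_edges_meeting_le:
  assumes E: "uniform_hypergraph k V E" and U: "finite U" "v \<notin> U"
  shows "card {e \<in> E. v \<in> e \<and> e \<inter> U \<noteq> {}} \<le> card U * ((card V - 2) choose (k - 2))"
proof -
  have "{e \<in> E. v \<in> e \<and> e \<inter> U \<noteq> {}} = (\<Union>u\<in>U. {e \<in> E. v \<in> e \<and> u \<in> e})" by auto
  then have "card {e \<in> E. v \<in> e \<and> e \<inter> U \<noteq> {}} \<le> (\<Sum>u\<in>U. card {e \<in> E. v \<in> e \<and> u \<in> e})"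
    by (simp add: card_UN_le U)
  also have "\<dots> \<le> (\<Sum>u\<in>U. (card V - 2) choose (k - 2))"
    using U by (intro sum_mono codegree_le[OF E]) auto
  finally show ?thesis by simp
qed

section \<open>Rainbow matchings by averaging\<close>

definition rainbow_matching :: "'i set \<Rightarrow> ('i \<Rightarrow> 'a set set) \<Rightarrow> ('i \<Rightarrow> 'a set) \<Rightarrow> bool" where
  "rainbow_matching I F f \<longleftrightarrow> (\<forall>i\<in>I. f i \<in> F i) \<and> disjoint_family_on f I"

lemma rainbow_matching_empty: "rainbow_matching {} F f"
  by (simp add: rainbow_matching_def disjoint_family_on_def)

lemma choose_disjoint_commute:
  assumes "a + b \<le> n"
  shows "(n choose a) * ((n - a) choose b) = (n choose b) * ((n - b) choose a)"
proof -
  have "real (n choose a) * real ((n - a) choose b) = real (n choose b) * real ((n - b) choose a)"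
    using assms by (simp add: binomial_fact add.commute)
  then show ?thesis by (metis of_nat_eq_iff of_nat_mult)
qed

text \<open>
  This is the union bound for a random family of disjoint sets \<open>e i\<close> of sizes \<open>k i\<close>: the \<open>i\<close>-th
  summand is the probability that \<open>e i \<notin> F i\<close>, as \<open>e i\<close> alone is a uniformly random set.
  The sets are chosen one after the other by the method of conditional expectations: some choice of
  the first set keeps the expected number of failures below 1.
\<close>
lemma rainbow_matching_if_dense:
  fixes V :: "'a set"
  assumes "finite I"
    and "\<And>i. i \<in> I \<Longrightarrow> uniform_hypergraph (k i) V (F i)"
    and "finite V" and "(\<Sum>i\<in>I. k i) \<le> card V"
    and "(\<Sum>i\<in>I. 1 - real (card (F i)) / real (card V choose k i)) < 1"
  shows "\<exists>f. rainbow_matching I F f"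
  using assms
proof (induction I arbitrary: V F rule: finite_induct)
  case empty
  then show ?case by (simp add: rainbow_matching_empty)
next
  case (insert a I)
  define n where "n = card V"
  define S where "S = {e. e \<subseteq> V \<and> card e = k a}"
  define G where "G e i = {f \<in> F i. f \<inter> e = {}}" for e i
  \<comment> \<open>The expected number of failures in \<open>I\<close> once \<open>e\<close> has been chosen for \<open>a\<close>.\<close>
  define miss where "miss e = (\<Sum>i\<in>I. 1 - real (card (G e i)) / real ((n - k a) choose k i))" for e
  have finS: "finite S" and cardS: "card S = n choose k a"
    unfolding S_def n_def using n_subsets insert.prems(2) by auto
  have sumk: "k a + (\<Sum>i\<in>I. k i) \<le> n" using insert by (simp add: n_def)
  have ki: "k a + k i \<le> n" if "i \<in> I" for i
    using sumk member_le_sum[of i I k] that insert.hyps by simp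
  have Fa: "F a \<subseteq> S" using insert.prems(1)[of a] by (auto simp: S_def uniform_hypergraph_def)
  have Gunif: "uniform_hypergraph (k i) (V - e) (G e i)" if "i \<in> I" for e i
    using insert.prems(1)[of i] that by (auto simp: G_def uniform_hypergraph_def)
  have cardVe: "card (V - e) = n - k a" if "e \<in> S" for e
    using that insert.prems(2) unfolding S_def n_def
    by (auto simp: card_Diff_subset finite_subset)
  have miss_nonneg: "miss e \<ge> 0" if "e \<in> S" for e
    unfolding miss_def
  proof (rule sum_nonneg)
    fix i assume i: "i \<in> I"
    have "card (G e i) \<le> (n - k a) choose k i"
      using uniform_hypergraph_card_le[OF Gunif[OF i, of e]] cardVe[OF that] by simp
    then show "0 \<le> 1 - real (card (G e i)) / real ((n - k a) choose k i)"
      by (auto simp: divide_le_eq)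
  qed
  \<comment> \<open>Averaged over \<open>e\<close>, the density of the part of \<open>F i\<close> disjoint from \<open>e\<close> is that of \<open>F i\<close>.\<close>
  have G_total: "(\<Sum>e\<in>S. real (card (G e i)) / real ((n - k a) choose k i))
      = real (card S) * (real (card (F i)) / real (n choose k i))" if i: "i \<in> I" for i
  proof -
    have u: "uniform_hypergraph (k i) V (F i)" using insert.prems(1) i by simp
    have "(\<Sum>e\<in>S. card {f \<in> F i. f \<inter> e = {}}) = ((n - k i) choose k a) * card (F i)"
    proof (rule sum_multicount)
      show "\<forall>f\<in>F i. card {e \<in> S. f \<inter> e = {}} = (n - k i) choose k a"
      proof
        fix f assume f: "f \<in> F i"
        have "{e \<in> S. f \<inter> e = {}} = {e. e \<subseteq> V - f \<and> card e = k a}"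
          by (auto simp: S_def)
        moreover have "card (V - f) = n - k i"
          using f u unfolding uniform_hypergraph_def n_def
          by (auto simp: card_Diff_subset finite_subset)
        ultimately show "card {e \<in> S. f \<inter> e = {}} = (n - k i) choose k a"
          using n_subsets[of "V - f" "k a"] insert.prems(2) by simp
      qed
    qed (use finS uniform_hypergraph_finite[OF u] in auto)
    then have count: "(\<Sum>e\<in>S. real (card (G e i))) = real ((n - k i) choose k a) * real (card (F i))"
      unfolding G_def by (metis (mono_tags, lifting) of_nat_mult of_nat_sum sum.cong)
    have pos: "real ((n - k a) choose k i) > 0" "real (n choose k i) > 0"
      using ki[OF i] by (auto simp: zero_less_binomial_iff)
    have ch: "real (n choose k a) * real ((n - k a) choose k i)
        = real (n choose k i) * real ((n - k i) choose k a)"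
      using choose_disjoint_commute[OF ki[OF i]] by (metis of_nat_mult)
    show ?thesis
      unfolding sum_divide_distrib[symmetric] count cardS using pos ch
      by (simp add: field_simps)
  qed
  have total: "(\<Sum>e\<in>S. (if e \<in> F a then 0 else 1) + miss e)
      = real (card S) * (\<Sum>i\<in>insert a I. 1 - real (card (F i)) / real (n choose k i))"
  proof -
    have "(\<Sum>e\<in>S. if e \<in> F a then 0 else 1 :: real) = real (card (S - F a))"
      using finS by (simp add: sum.If_cases Diff_eq)
    also have "\<dots> = real (card S) - real (card (F a))"
      using Fa finS by (simp add: card_Diff_subset finite_subset card_mono of_nat_diff)
    also have "\<dots> = real (card S) * (1 - real (card (F a)) / real (n choose k a))"
      using sumk unfolding cardS by (simp add: field_simps)
    finally have 1: "(\<Sum>e\<in>S. if e \<in> F a then 0 else 1 :: real)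
        = real (card S) * (1 - real (card (F a)) / real (n choose k a))" .
    have "(\<Sum>e\<in>S. miss e)
        = (\<Sum>i\<in>I. \<Sum>e\<in>S. 1 - real (card (G e i)) / real ((n - k a) choose k i))"
      unfolding miss_def by (rule sum.swap)
    also have "\<dots> = (\<Sum>i\<in>I. real (card S) * (1 - real (card (F i)) / real (n choose k i)))"
      by (intro sum.cong refl) (simp add: sum_subtractf G_total right_diff_distrib)
    finally show ?thesis
      using insert.hyps by (simp add: sum.distrib 1 distrib_left sum_distrib_left)
  qed
  have "\<exists>e\<in>S. (if e \<in> F a then 0 else 1) + miss e < 1"
  proof (rule ccontr)
    assume "\<not> ?thesis"
    then have "real (card S) * 1 \<le> (\<Sum>e\<in>S. (if e \<in> F a then 0 else 1) + miss e)"
      by (intro sum_bounded_below) (auto simp: not_less)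
    moreover have "real (card S) > 0" using sumk by (simp add: cardS zero_less_binomial_iff)
    moreover have "real (card S) * (\<Sum>i\<in>insert a I. 1 - real (card (F i)) / real (n choose k i))
        < real (card S) * 1"
      using insert.prems(4) \<open>real (card S) > 0\<close> unfolding n_def by (intro mult_strict_left_mono) auto
    ultimately show False using total by linarith
  qed
  then obtain e where e: "e \<in> S" "(if e \<in> F a then 0 else 1) + miss e < 1" by blast
  with miss_nonneg[of e] have eF: "e \<in> F a" and "miss e < 1" by (auto split: if_splits)
  have "\<exists>f. rainbow_matching I (G e) f"
  proof (rule insert.IH[of "V - e" "G e"])
    show "(\<Sum>i\<in>I. k i) \<le> card (V - e)" using sumk cardVe[OF e(1)] by simp
    show "(\<Sum>i\<in>I. 1 - real (card (G e i)) / real (card (V - e) choose k i)) < 1"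
      using \<open>miss e < 1\<close> by (simp add: miss_def cardVe[OF e(1)])
  qed (use Gunif insert.prems(2) in auto)
  then obtain f where f: "rainbow_matching I (G e) f" by blast
  have "rainbow_matching (insert a I) F (f(a := e))"
    using f eF insert.hyps(2)
    by (fastforce simp: rainbow_matching_def disjoint_family_on_def G_def)
  then show ?case by blast
qed

section \<open>Compression away from a vertex\<close>

text \<open>
  The sets on which the usual shift, replacing \<open>z\<close> by \<open>x\<close>, acts. Sets that contain both \<open>x\<close> and
  \<open>z\<close> are fixed by the transposition, so they are excluded by the last condition.
\<close>
definition movable :: "'a \<Rightarrow> 'a \<Rightarrow> 'a set set \<Rightarrow> 'a set set" where
  "movable x z F = {e \<in> F. z \<in> e \<and> transpose x z ` e \<notin> F}"

definition shift :: "'a \<Rightarrow> 'a \<Rightarrow> 'a set set \<Rightarrow> 'a set set" where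
  "shift x z F = (F - movable x z F) \<union> (`) (transpose x z) ` movable x z F"

lemma transpose_image_image [simp]: "transpose x z ` transpose x z ` e = e"
  by (simp add: image_image)

lemma movable_not_mem: "e \<in> movable x z F \<Longrightarrow> x \<notin> e"
  unfolding movable_def by auto

lemma movable_image:
  assumes "e \<in> movable x z F"
  shows "x \<in> transpose x z ` e" "z \<notin> transpose x z ` e"
  using assms movable_not_mem[OF assms] unfolding in_transpose_image_iff
  by (simp_all add: movable_def)

lemma inj_image_transpose: "inj_on ((`) (transpose x z)) A"
  by (metis inj_onI transpose_image_image)

lemma card_shift:
  assumes "finite F"
  shows "card (shift x z F) = card F"
proof -
  let ?D = "movable x z F"
  have D: "?D \<subseteq> F" by (auto simp: movable_def)
  have "card (shift x z F) = card (F - ?D) + card ((`) (transpose x z) ` ?D)"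
    unfolding shift_def
    by (rule card_Un_disjoint) (use assms D in \<open>auto simp: movable_def\<close>)
  also have "\<dots> = card (F - ?D) + card ?D"
    by (simp add: card_image inj_image_transpose)
  finally show ?thesis
    using assms D by (simp add: card_Diff_subset finite_subset card_mono)
qed

lemma uniform_hypergraph_shift:
  assumes "uniform_hypergraph k V F" "x \<in> V" "z \<in> V"
  shows "uniform_hypergraph k V (shift x z F)"
proof -
  have "transpose x z ` e \<subseteq> V \<and> card (transpose x z ` e) = k" if "e \<in> F" for e
  proof
    have "transpose x z ` e \<subseteq> transpose x z ` V"
      using assms(1) that by (intro image_mono) (auto simp: uniform_hypergraph_def)
    then show "transpose x z ` e \<subseteq> V" using assms by simp
    show "card (transpose x z ` e) = k"
      using assms(1) that by (simp add: card_image uniform_hypergraph_def)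
  qed
  then show ?thesis
    using assms(1) unfolding uniform_hypergraph_def shift_def movable_def by blast
qed

lemma degree_shift_le:
  assumes "finite F"
  shows "degree (shift x z F) z \<le> degree F z"
    and "movable x z F \<noteq> {} \<Longrightarrow> degree (shift x z F) z < degree F z"
proof -
  have eq: "{e \<in> shift x z F. z \<in> e} = {e \<in> F. z \<in> e} - movable x z F"
    using movable_image(2)[of _ x z F] unfolding shift_def by blast
  show "degree (shift x z F) z \<le> degree F z"
    unfolding degree_def eq using assms by (intro card_mono) auto
  show "degree (shift x z F) z < degree F z" if "movable x z F \<noteq> {}"
    unfolding degree_def eq using assms that
    by (intro psubset_card_mono) (auto simp: movable_def)
qed

text \<open>
  If some \<open>f i\<close> is a set newly created by the shift, then it contains \<open>x\<close>, so no other \<open>f j\<close> does.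
  Applying the transposition to all the sets then undoes the shift: it leaves the sets without \<open>z\<close>
  unchanged, and a set in the shifted family that contains \<open>z\<close> but not \<open>x\<close> was not moved precisely
  because its image was already in the family.
\<close>
lemma rainbow_matching_unshift:
  assumes f: "rainbow_matching I (\<lambda>i. shift x z (F i)) f"
  shows "\<exists>g. rainbow_matching I F g"
proof (cases "\<forall>i\<in>I. f i \<in> F i")
  case True
  then have "rainbow_matching I F f" using f by (simp add: rainbow_matching_def)
  then show ?thesis by blast
next
  case False
  then obtain j where j: "j \<in> I" "f j \<notin> F j" by auto
  have mem: "f i \<in> shift x z (F i)" if "i \<in> I" for i
    using f that by (simp add: rainbow_matching_def)
  have disj: "f i \<inter> f j = {}" if "i \<in> I" "j \<in> I" "i \<noteq> j" for i j
    using f that unfolding rainbow_matching_def disjoint_family_on_def by blast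
  have moved: "x \<in> f i \<and> transpose x z ` f i \<in> F i" if i: "i \<in> I" "f i \<notin> F i" for i
  proof -
    obtain d where "d \<in> movable x z (F i)" "f i = transpose x z ` d"
      using mem[OF i(1)] i(2) unfolding shift_def by blast
    then show ?thesis using movable_image(1)[of d x z "F i"] by (simp add: movable_def)
  qed
  have "transpose x z ` f i \<in> F i" if i: "i \<in> I" for i
  proof (cases "f i \<in> F i")
    case False
    then show ?thesis using moved i by blast
  next
    case True
    then have "i \<noteq> j" using j by auto
    then have x: "x \<notin> f i" using moved[OF j] disj[OF i j(1)] by auto
    show ?thesis
    proof (cases "z \<in> f i")
      case z: True
      have "f i \<notin> movable x z (F i)"
      proof
        assume "f i \<in> movable x z (F i)"
        then obtain d where "d \<in> movable x z (F i)" "f i = transpose x z ` d"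
          using mem[OF i] unfolding shift_def by blast
        then have "x \<in> f i" using movable_image(1)[of d x z "F i"] by simp
        then show False using x by simp
      qed
      then show ?thesis using True z by (auto simp: movable_def)
    next
      case False
      then show ?thesis using x True by simp
    qed
  qed
  moreover have "disjoint_family_on (\<lambda>i. transpose x z ` f i) I"
    unfolding disjoint_family_on_def
  proof (intro ballI impI)
    fix i j assume "i \<in> I" "j \<in> I" "i \<noteq> j"
    then show "transpose x z ` f i \<inter> transpose x z ` f j = {}"
      using disj[of i j] by (simp flip: image_Int[OF inj_transpose])
  qed
  ultimately have "rainbow_matching I F (\<lambda>i. transpose x z ` f i)"
    by (simp add: rainbow_matching_def)
  then show ?thesis by blast
qed

definition compressed :: "'a set \<Rightarrow> 'a \<Rightarrow> 'a set set \<Rightarrow> bool" where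
  "compressed V z F \<longleftrightarrow> (\<forall>x\<in>V. movable x z F = {})"

lemma compressed_insert:
  assumes "compressed V z F" "insert z e \<in> F" "z \<notin> e" "x \<in> V" "x \<notin> e"
  shows "insert x e \<in> F"
proof -
  have "transpose x z ` insert z e = insert x e" using assms(3,5) by simp
  moreover have "transpose x z ` insert z e \<in> F"
    using assms(1,2,4) unfolding compressed_def movable_def by blast
  ultimately show ?thesis by metis
qed

text \<open>
  Each shift that changes a family lowers the number of its sets containing \<open>z\<close>, so repeated shifting
  terminates.
\<close>
lemma exists_compressed:
  assumes "finite I" and "z \<in> V" and "\<And>i. i \<in> I \<Longrightarrow> uniform_hypergraph (k i) V (F i)"
  shows "\<exists>G. (\<forall>i\<in>I. uniform_hypergraph (k i) V (G i) \<and> card (G i) = card (F i) \<and> compressed V z (G i))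
    \<and> ((\<exists>g. rainbow_matching I G g) \<longrightarrow> (\<exists>f. rainbow_matching I F f))"
  using assms(3)
proof (induction "\<Sum>i\<in>I. degree (F i) z" arbitrary: F rule: less_induct)
  case less
  show ?case
  proof (cases "\<forall>i\<in>I. compressed V z (F i)")
    case True
    then show ?thesis by (intro exI[of _ F]) (simp add: less.prems)
  next
    case False
    then obtain j x where j: "j \<in> I" "x \<in> V" "movable x z (F j) \<noteq> {}"
      by (auto simp: compressed_def)
    let ?F = "\<lambda>i. shift x z (F i)"
    have fin: "finite (F i)" if "i \<in> I" for i
      using uniform_hypergraph_finite(2)[OF less.prems[OF that]] .
    have "(\<Sum>i\<in>I. degree (?F i) z) < (\<Sum>i\<in>I. degree (F i) z)"
    proof (rule sum_strict_mono_ex1)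
      show "\<forall>i\<in>I. degree (?F i) z \<le> degree (F i) z"
        using degree_shift_le(1)[OF fin] by simp
      show "\<exists>i\<in>I. degree (?F i) z < degree (F i) z"
        using degree_shift_le(2)[OF fin[OF j(1)] j(3)] j(1) by blast
    qed (rule \<open>finite I\<close>)
    moreover have "uniform_hypergraph (k i) V (?F i)" if "i \<in> I" for i
      using uniform_hypergraph_shift[OF less.prems[OF that] j(2) \<open>z \<in> V\<close>] .
    ultimately have "\<exists>G. (\<forall>i\<in>I. uniform_hypergraph (k i) V (G i) \<and> card (G i) = card (?F i)
        \<and> compressed V z (G i))
      \<and> ((\<exists>g. rainbow_matching I G g) \<longrightarrow> (\<exists>f. rainbow_matching I ?F f))"
      by (rule less.hyps)
    then obtain G where "(\<forall>i\<in>I. uniform_hypergraph (k i) V (G i) \<and> card (G i) = card (?F i)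
        \<and> compressed V z (G i))
      \<and> ((\<exists>g. rainbow_matching I G g) \<longrightarrow> (\<exists>f. rainbow_matching I ?F f))" ..
    moreover have "\<exists>f. rainbow_matching I F f" if "\<exists>f. rainbow_matching I ?F f"
      using that rainbow_matching_unshift[of I x z F] by blast
    ultimately show ?thesis by (intro exI[of _ G]) (simp add: card_shift fin)
  qed
qed

section \<open>Rainbow matchings in large families\<close>

definition link :: "'a \<Rightarrow> 'a set set \<Rightarrow> 'a set set" where
  "link z F = {e. z \<notin> e \<and> insert z e \<in> F}"

definition deletion :: "'a \<Rightarrow> 'a set set \<Rightarrow> 'a set set" where
  "deletion z F = {e \<in> F. z \<notin> e}"

lemma card_link: "card (link z F) = degree F z"
proof -
  have "bij_betw (insert z) (link z F) {e \<in> F. z \<in> e}"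
    by (rule bij_betw_byWitness[where f' = "\<lambda>e. e - {z}"]) (auto simp: link_def insert_absorb)
  then show ?thesis by (simp add: bij_betw_same_card degree_def)
qed

lemma card_link_deletion:
  assumes "finite F"
  shows "card F = card (link z F) + card (deletion z F)"
proof -
  have "F = {e \<in> F. z \<in> e} \<union> deletion z F" by (auto simp: deletion_def)
  moreover have "card ({e \<in> F. z \<in> e} \<union> deletion z F) = card {e \<in> F. z \<in> e} + card (deletion z F)"
    by (rule card_Un_disjoint) (use assms in \<open>auto simp: deletion_def\<close>)
  ultimately show ?thesis by (simp add: card_link degree_def)
qed

lemma uniform_hypergraph_deletion:
  "uniform_hypergraph k V F \<Longrightarrow> uniform_hypergraph k (V - {z}) (deletion z F)"
  by (auto simp: uniform_hypergraph_def deletion_def)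

lemma uniform_hypergraph_link:
  assumes "uniform_hypergraph k V F"
  shows "uniform_hypergraph (k - 1) (V - {z}) (link z F)"
proof -
  have "e \<subseteq> V - {z} \<and> card e = k - 1" if e: "e \<in> link z F" for e
  proof -
    have "insert z e \<subseteq> V" "card (insert z e) = k" "z \<notin> e" "finite V"
      using e assms by (auto simp: link_def uniform_hypergraph_def)
    moreover from this have "finite e" using finite_subset[of "insert z e" V] by simp
    ultimately show ?thesis by (simp add: subset_Diff_insert)
  qed
  then show ?thesis using assms by (simp add: uniform_hypergraph_def)
qed

text \<open>
  For positive \<open>k\<close> the size condition says \<open>card F > s * (n choose (k - 1))\<close>, and the right-hand side
  is the sum of the corresponding bounds for link and deletion, by Pascal's rule. Multiplying by the
  size of the ground set makes the bound zero for \<open>k = 0\<close>, as the theorem on large families needs: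
  iterated links lead to families of empty sets, which cause no difficulty as long as they are
  nonempty.
\<close>
lemma large_link_or_deletion:
  assumes "finite F" and n: "n > 0" and large: "s * k * (Suc n choose k) < Suc n * card F"
    and k0: "k = 0 \<Longrightarrow> deletion z F \<noteq> {}"
  shows "(k > 0 \<and> s * (k - 1) * (n choose (k - 1)) < n * card (link z F))
    \<or> s * k * (n choose k) < n * card (deletion z F)"
proof (cases k)
  case 0
  then show ?thesis using k0 n \<open>finite F\<close> by (simp add: card_gt_0_iff deletion_def)
next
  case (Suc j)
  obtain m where m: "n = Suc m" using n by (cases n) auto
  have absorb: "Suc j * (Suc m choose Suc j) = Suc m * (m choose j)" for m j
    by (rule Suc_times_binomial)
  have "s * (Suc j * (Suc n choose Suc j)) < Suc n * card F"
    using large by (simp only: Suc mult.assoc)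
  then have "Suc n * (s * (n choose j)) < Suc n * card F"
    by (simp only: absorb mult.left_commute)
  then have F: "s * (n choose j) < card F" using mult_less_cancel1 by blast
  have "j * (n choose j) + Suc j * (n choose Suc j) = n * (n choose j)"
  proof (cases j)
    case 0
    then show ?thesis by simp
  next
    case (Suc i)
    then show ?thesis unfolding Suc m absorb by (simp only: binomial_Suc_Suc distrib_left)
  qed
  then have "s * j * (n choose j) + s * Suc j * (n choose Suc j) = n * (s * (n choose j))"
    by (metis (no_types, lifting) distrib_left mult.assoc mult.left_commute)
  also have "\<dots> < n * card F" using F n by simp
  also have "\<dots> = n * card (link z F) + n * card (deletion z F)"
    by (simp add: card_link_deletion[OF \<open>finite F\<close>, of z] distrib_left)
  finally show ?thesis by (auto simp: Suc)
qed

text \<open>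
  By absorption, the size condition is
  \<open>card (F i) > (card I - 1) * ((card V - 1) choose (k i - 1))\<close> when \<open>k i > 0\<close>.
\<close>
theorem rainbow_matching_if_large:
  fixes V :: "'a set"
  assumes "finite V" and "finite I"
    and "\<And>i. i \<in> I \<Longrightarrow> uniform_hypergraph (k i) V (F i)"
    and "(\<Sum>i\<in>I. k i) \<le> card V"
    and "\<And>i. i \<in> I \<Longrightarrow> (card I - 1) * k i * (card V choose k i) < card V * card (F i)"
  shows "\<exists>f. rainbow_matching I F f"
  using assms
proof (induction "card V" arbitrary: V k F)
  case 0
  then have "I = {}" by fastforce
  then show ?case by (simp add: rainbow_matching_empty)
next
  case (Suc n)
  note unif = Suc.prems(3)
  have ne: "F i \<noteq> {}" if "i \<in> I" for i using Suc.prems(5)[OF that] by auto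
  consider "I = {}" | "I \<noteq> {}" "(\<Sum>i\<in>I. k i) = Suc n" | "(\<Sum>i\<in>I. k i) = 0"
    | "(\<Sum>i\<in>I. k i) \<le> n" "n > 0"
    using Suc.prems(4) Suc.hyps(2) by linarith
  then show ?case
  proof cases
    case 1
    then show ?thesis using rainbow_matching_empty by blast
  next
    case 2
    \<comment> \<open>The sizes add up to \<open>card V\<close>, so the failure probabilities add up to less than
      \<open>card I - (card I - 1)\<close>.\<close>
    show ?thesis
    proof (rule rainbow_matching_if_dense[OF \<open>finite I\<close> unif \<open>finite V\<close> Suc.prems(4)])
      let ?s = "real (card I)"
      have s: "real (card I - 1) = ?s - 1" 
        using 2(1) \<open>finite I\<close> by (simp add: Suc_leI card_gt_0_iff of_nat_diff)
      have "1 - real (card (F i)) / real (card V choose k i) < 1 - (?s - 1) * real (k i) / Suc n"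
        if i: "i \<in> I" for i
      proof -
        have "k i \<le> card V" using member_le_sum[of i I k] i Suc.prems(2,4) by simp
        then have pos: "real (card V choose k i) > 0" by (simp add: zero_less_binomial_iff)
        have "real ((card I - 1) * k i * (card V choose k i)) < real (card V * card (F i))"
          using Suc.prems(5)[OF i] by (simp only: of_nat_less_iff)
        then have "(?s - 1) * real (k i) * real (card V choose k i) < real (Suc n) * real (card (F i))"
          by (simp only: of_nat_mult s Suc.hyps(2)[symmetric])
        then show ?thesis using pos by (simp add: field_simps)
      qed
      then have "(\<Sum>i\<in>I. 1 - real (card (F i)) / real (card V choose k i))
          < (\<Sum>i\<in>I. 1 - (?s - 1) * real (k i) / Suc n)"
        using 2(1) Suc.prems(2) by (intro sum_strict_mono) auto
      also have "\<dots> = ?s - (?s - 1) * real (\<Sum>i\<in>I. k i) / Suc n"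
        by (simp add: sum_subtractf sum_divide_distrib sum_distrib_left)
      also have "\<dots> = 1" by (simp add: 2(2))
      finally show "(\<Sum>i\<in>I. 1 - real (card (F i)) / real (card V choose k i)) < 1" .
    qed
  next
    case 3
    have "{} \<in> F i" if i: "i \<in> I" for i
    proof -
      obtain e where "e \<in> F i" using ne[OF i] by blast
      moreover have "k i = 0" using 3 i \<open>finite I\<close> by simp
      ultimately show ?thesis
        using unif[OF i] uniform_hypergraph_finite(3)[OF unif[OF i], of e]
        by (auto simp: uniform_hypergraph_def)
    qed
    then have "rainbow_matching I F (\<lambda>i. {})"
      by (simp add: rainbow_matching_def disjoint_family_on_def)
    then show ?thesis by blast
  next
    case 4
    obtain z where z: "z \<in> V" using Suc.hyps(2) by (metis card.empty ex_in_conv nat.simps(3))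
    obtain G where compression: "(\<forall>i\<in>I. uniform_hypergraph (k i) V (G i)
          \<and> card (G i) = card (F i) \<and> compressed V z (G i))
        \<and> ((\<exists>g. rainbow_matching I G g) \<longrightarrow> (\<exists>f. rainbow_matching I F f))"
      using exists_compressed[OF \<open>finite I\<close> z unif] ..
    then have G: "\<And>i. i \<in> I \<Longrightarrow> uniform_hypergraph (k i) V (G i)"
        "\<And>i. i \<in> I \<Longrightarrow> card (G i) = card (F i)" "\<And>i. i \<in> I \<Longrightarrow> compressed V z (G i)"
      by simp_all
    have finG: "finite (G i)" if "i \<in> I" for i using uniform_hypergraph_finite(2)[OF G(1)[OF that]] .
    \<comment> \<open>The indices for which the induction hypothesis is applied to the link of \<open>z\<close>.\<close>
    define J where "J = {i \<in> I. k i > 0 \<and>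
      (card I - 1) * (k i - 1) * (n choose (k i - 1)) < n * card (link z (G i))}"
    define k' where "k' i = (if i \<in> J then k i - 1 else k i)" for i
    define G' where "G' i = (if i \<in> J then link z (G i) else deletion z (G i))" for i
    have cV: "card (V - {z}) = n" using z Suc.hyps(2) \<open>finite V\<close> by simp
    have JI: "J \<subseteq> I" by (auto simp: J_def)
    then have finJ: "finite J" using \<open>finite I\<close> finite_subset by blast
    have k_split: "(\<Sum>i\<in>I. k i) = (\<Sum>i\<in>I. k' i) + card J"
    proof -
      have "(\<Sum>i\<in>I. k i) = (\<Sum>i\<in>I. k' i + (if i \<in> J then 1 else 0))"
        by (intro sum.cong) (auto simp: k'_def J_def)
      also have "\<dots> = (\<Sum>i\<in>I. k' i) + card J"
        using \<open>finite I\<close> JI by (simp add: sum.distrib sum.If_cases Int_absorb1)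
      finally show ?thesis .
    qed
    have unif': "uniform_hypergraph (k' i) (V - {z}) (G' i)" if "i \<in> I" for i
      using uniform_hypergraph_link[OF G(1)[OF that]] uniform_hypergraph_deletion[OF G(1)[OF that]]
      by (simp add: k'_def G'_def)
    have "\<exists>g. rainbow_matching I G' g"
    proof (rule Suc.hyps(1))
      show "n = card (V - {z})" by (simp add: cV)
      show "(\<Sum>i\<in>I. k' i) \<le> card (V - {z})" using 4(1) k_split cV by simp
      fix i assume i: "i \<in> I"
      show "uniform_hypergraph (k' i) (V - {z}) (G' i)" by (rule unif'[OF i])
      have "(k i > 0 \<and> (card I - 1) * (k i - 1) * (n choose (k i - 1)) < n * card (link z (G i)))
          \<or> (card I - 1) * k i * (n choose k i) < n * card (deletion z (G i))"
      proof (rule large_link_or_deletion[OF finG[OF i] 4(2)])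
        show "(card I - 1) * k i * (Suc n choose k i) < Suc n * card (G i)"
          using Suc.prems(5)[OF i] by (simp only: Suc.hyps(2) G(2)[OF i])
        assume k0: "k i = 0"
        have "G i \<noteq> {}" using ne[OF i] G(2)[OF i] finG[OF i] uniform_hypergraph_finite(2)[OF unif[OF i]]
          by (metis card_0_eq)
        then obtain e where e: "e \<in> G i" by blast
        then have "card e = 0" "finite e"
          using G(1)[OF i] k0 uniform_hypergraph_finite(3)[OF G(1)[OF i] e]
          by (simp_all add: uniform_hypergraph_def)
        then have "e = {}" by simp
        then show "deletion z (G i) \<noteq> {}" using e by (auto simp: deletion_def)
      qed
      then show "(card I - 1) * k' i * (card (V - {z}) choose k' i) < card (V - {z}) * card (G' i)"
        using i unfolding cV k'_def G'_def by (auto simp: J_def)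
    qed (use \<open>finite I\<close> \<open>finite V\<close> in auto)
    then obtain g where g: "rainbow_matching I G' g" by blast
    have gG: "g i \<in> G' i" if "i \<in> I" for i using g that by (simp add: rainbow_matching_def)
    have gd: "g i \<inter> g j = {}" if "i \<in> I" "j \<in> I" "i \<noteq> j" for i j
      using g that by (auto simp: rainbow_matching_def disjoint_family_on_def)
    have gV: "g i \<subseteq> V - {z}" "card (g i) = k' i" if "i \<in> I" for i
      using unif'[OF that] gG[OF that] by (auto simp: uniform_hypergraph_def)
    define U where "U = (\<Union>i\<in>I. g i)"
    have "card U \<le> (\<Sum>i\<in>I. k' i)"
      using card_UN_le[OF \<open>finite I\<close>, of g] gV(2) by (simp add: U_def)
    moreover have UV: "U \<subseteq> V" using gV(1) by (auto simp: U_def)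
    ultimately have "card J \<le> card (V - U)"
      using 4(1) k_split Suc.hyps(2) \<open>finite V\<close> by (simp add: card_Diff_subset finite_subset)
    \<comment> \<open>Distinct elements to complete the sets that come from links; \<open>z\<close> itself may be one of them.\<close>
    then obtain h where h: "h ` J \<subseteq> V - U" "inj_on h J"
      using card_le_inj[OF finJ, of "V - U"] \<open>finite V\<close> by blast
    define f where "f i = (if i \<in> J then insert (h i) (g i) else g i)" for i
    have "f i \<in> G i" if i: "i \<in> I" for i
    proof (cases "i \<in> J")
      case False
      then show ?thesis using gG[OF i] by (simp add: f_def G'_def deletion_def)
    next
      case True
      then have "insert z (g i) \<in> G i" "z \<notin> g i" using gG[OF i] by (auto simp: G'_def link_def)
      moreover have "h i \<in> V" "h i \<notin> g i" using True h(1) i by (auto simp: U_def)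
      ultimately show ?thesis
        using compressed_insert[OF G(3)[OF i]] True by (simp add: f_def)
    qed
    moreover have "f i \<inter> f j = {}" if ij: "i \<in> I" "j \<in> I" "i \<noteq> j" for i j
    proof -
      have "h i \<notin> g j" if "i \<in> J" using that h(1) ij by (auto simp: U_def)
      moreover have "h j \<notin> g i" if "j \<in> J" using that h(1) ij by (auto simp: U_def)
      moreover have "h i \<noteq> h j" if "i \<in> J" "j \<in> J" using that h(2) ij by (auto dest: inj_onD)
      ultimately show ?thesis using gd[OF ij] by (auto simp: f_def)
    qed
    ultimately have "rainbow_matching I G f"
      by (simp add: rainbow_matching_def disjoint_family_on_def)
    then show ?thesis using compression by blast
  qed
qed

section \<open>Matchings from vertices of large degree\<close>

lemma matching_insert:
  assumes "matching E M" "e \<in> E" "e \<inter> \<Union>M = {}"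
  shows "matching E (insert e M)"
  using assms unfolding matching_def disjoint_def by blast

lemma matching_subset: "matching E M \<Longrightarrow> N \<subseteq> M \<Longrightarrow> matching E N"
  unfolding matching_def by (meson pairwise_subset subset_trans)

lemma card_Union_matching_le:
  assumes "uniform_hypergraph k V E" "matching E M"
  shows "card (\<Union>M) \<le> k * card M"
proof -
  have "card (\<Union>M) \<le> (\<Sum>e\<in>M. card e)" by (rule card_Union_le_sum_card)
  also have "\<dots> = (\<Sum>e\<in>M. k)"
    using assms by (intro sum.cong) (auto simp: uniform_hypergraph_def matching_def)
  finally show ?thesis by (simp add: mult.commute)
qed

text \<open>
  For \<open>v \<in> S\<close> consider the edges that meet \<open>S\<close> only in \<open>v\<close>, with \<open>v\<close> removed. At most
  \<open>card S - 1\<close> times the maximal codegree is lost by ignoring the other edges through \<open>v\<close>; this is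
  half of the assumed degree bound, and the other half makes these families on \<open>V - S\<close> large enough for a
  rainbow matching.
\<close>
lemma matching_if_many_large_degrees:
  fixes V :: "'a set"
  assumes E: "uniform_hypergraph k V E" and k: "2 \<le> k" and S: "S \<subseteq> V" "k * card S \<le> card V"
    and deg: "\<And>v. v \<in> S \<Longrightarrow> 2 * (card S - 1) * ((card V - 2) choose (k - 2)) < degree E v"
  shows "\<exists>M. matching E M \<and> card M = card S"
proof (cases "S = {}")
  case True
  then have "matching E {} \<and> card ({} :: 'a set set) = card S" by (simp add: matching_def)
  then show ?thesis by blast
next
  case False
  note fin = uniform_hypergraph_finite[OF E]
  have finS: "finite S" using S(1) fin(1) finite_subset by blast
  then have s: "card S \<ge> 1" using False by (simp add: Suc_leI card_gt_0_iff)
  define C where "C = (card V - 2) choose (k - 2)"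
  define F where "F v = {e. e \<inter> S = {} \<and> insert v e \<in> E}" for v
  have cVS: "card (V - S) = card V - card S" using S(1) finS by (simp add: card_Diff_subset)
  have "2 * card S \<le> card V" using S(2) k by (meson le_trans mult_le_mono1)
  then have "card V - card S = Suc (card V - card S - 1)" "card V - card S - 1 \<le> card V - 2"
    using s by linarith+
  then obtain m where m: "card V - card S = Suc m" "m \<le> card V - 2" by blast
  obtain j where j: "k - 1 = Suc j" "k - 2 = j" using k by (cases "k - 1") auto
  have Funif: "uniform_hypergraph (k - 1) (V - S) (F v)" if v: "v \<in> S" for v
  proof -
    have "e \<subseteq> V - S \<and> card e = k - 1" if e: "e \<in> F v" for e
    proof -
      have 1: "insert v e \<subseteq> V" "card (insert v e) = k" "e \<inter> S = {}"
        using e E by (auto simp: F_def uniform_hypergraph_def)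
      have "finite e" using fin(3)[of "insert v e"] e by (simp add: F_def)
      moreover have "v \<notin> e" using 1(3) v by blast
      ultimately have "card e = k - 1" using 1(2) by simp
      then show ?thesis using 1 by blast
    qed
    then show ?thesis using fin(1) by (simp add: uniform_hypergraph_def)
  qed
  have Flarge: "(card S - 1) * C < card (F v)" if v: "v \<in> S" for v
  proof -
    let ?A = "{e \<in> E. v \<in> e \<and> e \<inter> (S - {v}) = {}}" and ?B = "{e \<in> E. v \<in> e \<and> e \<inter> (S - {v}) \<noteq> {}}"
    have "bij_betw (insert v) (F v) ?A"
      by (rule bij_betw_byWitness[where f' = "\<lambda>e. e - {v}"])
        (use v in \<open>auto simp: F_def insert_absorb\<close>)
    then have "card (F v) = card ?A" by (rule bij_betw_same_card)
    moreover have "card ?B \<le> (card S - 1) * C"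
      using card_edges_meeting_le[OF E, of "S - {v}" v] finS v by (simp add: C_def)
    moreover have "degree E v \<le> card ?A + card ?B"
    proof -
      have "{e \<in> E. v \<in> e} = ?A \<union> ?B" by blast
      then show ?thesis using card_Un_le[of ?A ?B] by (simp add: degree_def)
    qed
    ultimately show ?thesis using deg[OF v] by (simp add: C_def)
  qed
  have "\<exists>f. rainbow_matching S F f"
  proof (rule rainbow_matching_if_large)
    have "card S * k \<le> card V" using S(2) by (simp add: mult.commute)
    moreover have "card S * (k - 1) + card S = card S * k"
      using k by (cases k) simp_all
    ultimately show "(\<Sum>v\<in>S. k - 1) \<le> card (V - S)" by (simp add: cVS)
    fix v assume v: "v \<in> S"
    show "uniform_hypergraph (k - 1) (V - S) (F v)" by (rule Funif[OF v])
    have "(card S - 1) * (k - 1) * (card (V - S) choose (k - 1))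
        = (card S - 1) * (Suc j * (Suc m choose Suc j))"
      by (simp only: cVS m(1) j(1) mult.assoc)
    also have "\<dots> = Suc m * ((card S - 1) * (m choose j))"
      by (simp only: Suc_times_binomial mult.left_commute)
    also have "\<dots> \<le> Suc m * ((card S - 1) * C)"
      unfolding C_def j(2) using m(2) by (intro mult_le_mono binomial_right_mono) auto
    also have "\<dots> < Suc m * card (F v)" using Flarge[OF v] by (intro mult_strict_left_mono) auto
    finally show "(card S - 1) * (k - 1) * (card (V - S) choose (k - 1)) < card (V - S) * card (F v)"
      by (simp only: cVS m(1))
  qed (use finS fin(1) in auto)
  then obtain f where f: "rainbow_matching S F f" by blast
  have fF: "f v \<inter> S = {}" "insert v (f v) \<in> E" if "v \<in> S" for v
    using f that by (simp_all add: rainbow_matching_def F_def)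
  have fd: "f v \<inter> f w = {}" if "v \<in> S" "w \<in> S" "v \<noteq> w" for v w
    using f that unfolding rainbow_matching_def disjoint_family_on_def by blast
  let ?g = "\<lambda>v. insert v (f v)"
  have gd: "?g v \<inter> ?g w = {}" if "v \<in> S" "w \<in> S" "v \<noteq> w" for v w
    using fd[OF that] fF(1)[OF that(1)] fF(1)[OF that(2)] that by blast
  have "inj_on ?g S"
  proof (rule inj_onI)
    fix v w assume "v \<in> S" "w \<in> S" "?g v = ?g w"
    then show "v = w" using gd[of v w] by blast
  qed
  then have "card (?g ` S) = card S" by (rule card_image)
  moreover have "matching E (?g ` S)"
    unfolding matching_def disjoint_def
  proof (intro conjI ballI impI)
    show "?g ` S \<subseteq> E" using fF(2) by blast
    fix a b assume "a \<in> ?g ` S" "b \<in> ?g ` S" "a \<noteq> b"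
    then show "a \<inter> b = {}" using gd by blast
  qed
  ultimately show ?thesis by blast
qed

section \<open>Degree conditions forcing a matching\<close>

text \<open>
  Both bounds estimate \<open>((m + s) choose Suc j) - (m choose Suc j)\<close>, which by Pascal's rule is the
  sum of \<open>i choose j\<close> over \<open>m \<le> i < m + s\<close>, by its least and its greatest summand.
\<close>
lemma choose_add_lower: "(m choose Suc j) + s * (m choose j) \<le> (m + s) choose Suc j"
proof (induction s)
  case (Suc s)
  have "m choose j \<le> (m + s) choose j" by (rule binomial_right_mono) simp
  then show ?case using Suc by simp
qed simp

lemma choose_add_upper: "(m + s) choose Suc j \<le> (m choose Suc j) + s * ((m + s - 1) choose j)"
proof (induction s)
  case (Suc s)
  have "(m + s - 1) choose j \<le> (m + s) choose j" by (rule binomial_right_mono) simp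
  then have "s * ((m + s - 1) choose j) \<le> s * ((m + s) choose j)" by (rule mult_le_mono2)
  with Suc have "(m + s) choose Suc j \<le> (m choose Suc j) + s * ((m + s) choose j)"
    by (rule le_trans[OF _ add_left_mono])
  then show ?case by simp
qed simp

text \<open>
  The difference \<open>((n - 1) choose (k - 1)) - ((n - 1 - s) choose (k - 1))\<close> is at least
  \<open>s * ((n - 1 - s) choose (k - 2))\<close>. Replacing
  \<open>(n - 1 - s) choose (k - 2)\<close> by \<open>(n - 2) choose (k - 2)\<close> costs a relative error of at most
  \<open>(s - 1) * (k - 2) / (n - 2)\<close>; this is absorbed by the difference between \<open>3 * k\<close> and
  \<open>3 * k - 2\<close>.
\<close>
lemma degree_condition_estimate:
  assumes k: "2 \<le> k" and s: "1 \<le> s" and n: "3 * k^2 * Suc s \<le> n"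
  shows "k * (3 * k - 2) * s^2 * ((n - 2) choose (k - 2)) + n * ((n - 1 - s) choose (k - 1))
    \<le> n * ((n - 1) choose (k - 1))"
proof -
  define j where "j = k - 2"
  define m where "m = n - 1 - s"
  define t where "t = s - 1"
  have "2^2 \<le> k^2" using k by (intro power_mono) auto
  then have "12 * Suc s \<le> 3 * k^2 * Suc s" by (intro mult_le_mono1) simp
  then have ns: "12 * Suc s \<le> n" using n by linarith
  have kj: "k = j + 2" and st: "s = Suc t" using k s by (auto simp: j_def t_def)
  have nm: "n = m + t + 2" using ns by (simp add: m_def st)
  let ?C = "(m + t) choose j" and ?c = "m choose j"
  have low: "(m choose Suc j) + s * ?c \<le> (n - 1) choose Suc j"
    using choose_add_lower[of m j s] by (simp add: nm st)
  \<comment> \<open>Absorption turns the loss \<open>t * ((m + t - 1) choose (j - 1))\<close> into a fraction of \<open>?C\<close>.\<close>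
  have up: "(m + t) * ?C \<le> (m + t) * ?c + t * j * ?C"
  proof (cases j)
    case (Suc i)
    show ?thesis
    proof (cases "m + t")
      case mt: (Suc p)
      have "?C \<le> ?c + t * (p choose i)" using choose_add_upper[of m t i] mt by (simp add: Suc)
      then have "Suc p * ?C \<le> Suc p * (?c + t * (p choose i))" by (rule mult_le_mono2)
      also have "\<dots> = Suc p * ?c + t * (Suc p * (p choose i))" by (simp only: distrib_left mult.left_commute)
      also have "Suc p * (p choose i) = j * ?C"
        by (simp only: Suc mt Suc_times_binomial)
      finally show ?thesis by (simp only: mt mult.assoc)
    qed simp
  qed simp
  have poly: "real (m + t) * (real k * (3 * real k - 2) * real s) \<le> real n * (real (m + t) - real t * real j)"
  proof -
    have "real (3 * k^2 * Suc s) \<le> real n" using n by (simp only: of_nat_le_iff)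
    then have "3 * real k ^ 2 * (real s + 1) \<le> real n" by (simp add: algebra_simps)
    then have "real k * (3 * real k - 2) * real s + 2 * (real k * real s) \<le> real n"
      by (simp add: algebra_simps power2_eq_square) (smt (verit) mult_nonneg_nonneg of_nat_0_le_iff)
    then have "real (m + t) * (real k * (3 * real k - 2) * real s + 2 * (real k * real s)) \<le> real (m + t) * real n"
      by (intro mult_left_mono) auto
    moreover have "real n * (real t * real j) \<le> (2 * real (m + t)) * (real s * real k)"
    proof (intro mult_mono)
      show "real n \<le> 2 * real (m + t)" using ns nm by simp
    qed (auto simp: kj st)
    ultimately show ?thesis by (simp add: algebra_simps)
  qed
  have pos: "real (m + t) > 0" using ns nm by simp
  have "real (m + t) * (real k * (3 * real k - 2) * real s ^ 2 * real ?C)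
      = (real (m + t) * (real k * (3 * real k - 2) * real s)) * (real s * real ?C)"
    by (simp add: power2_eq_square)
  also have "\<dots> \<le> (real n * (real (m + t) - real t * real j)) * (real s * real ?C)"
    using poly by (rule mult_right_mono) simp
  also have "\<dots> = real n * real s * (real (m + t) * real ?C - real t * real j * real ?C)"
    by (simp add: algebra_simps)
  also have "\<dots> \<le> real n * real s * (real (m + t) * real ?c)"
  proof (rule mult_left_mono)
    have "real ((m + t) * ?C) \<le> real ((m + t) * ?c + t * j * ?C)" using up by (simp only: of_nat_le_iff)
    then show "real (m + t) * real ?C - real t * real j * real ?C \<le> real (m + t) * real ?c"
      by (simp only: of_nat_mult of_nat_add)
  qed simp
  also have "\<dots> = real (m + t) * (real n * (real s * real ?c))" by simp
  finally have "real k * (3 * real k - 2) * real s ^ 2 * real ?C \<le> real n * (real s * real ?c)"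
    using pos by (rule mult_left_le_imp_le)
  moreover have "real (3 * k - 2) = 3 * real k - 2" using k by (simp add: of_nat_diff)
  ultimately have "real (k * (3 * k - 2) * s^2 * ?C) \<le> real (n * (s * ?c))" by simp
  then have "k * (3 * k - 2) * s^2 * ?C \<le> n * (s * ?c)" by (simp only: of_nat_le_iff)
  moreover have "n * ((m choose Suc j) + s * ?c) \<le> n * ((n - 1) choose Suc j)"
    using low by (rule mult_le_mono2)
  moreover have "n - 2 = m + t" "k - 2 = j" "k - 1 = Suc j" "n - 1 - s = m"
    by (simp_all add: nm kj st)
  ultimately show ?thesis by (simp only: distrib_left)
qed

text \<open>
  The vertices of a maximum matching meet every edge, so the number of edges is at most the sum of
  their degrees. There are at most \<open>k * s\<close> of them; each contributes \<open>2 * s * C\<close>, and at most \<open>s\<close> of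
  them contribute up to \<open>(k - 2) * s * C\<close> more.
\<close>
lemma card_edges_le_of_few_large_degrees:
  assumes E: "uniform_hypergraph k V E" and k: "2 \<le> k"
    and max: "\<And>v. v \<in> V \<Longrightarrow> degree E v \<le> k * s * C"
    and few: "card {v \<in> V. 2 * s * C < degree E v} \<le> s"
    and no_matching: "\<not> (\<exists>M. matching E M \<and> card M = Suc s)"
  shows "card E \<le> (3 * k - 2) * s^2 * C"
proof -
  note fin = uniform_hypergraph_finite[OF E]
  define A where "A = {v \<in> V. 2 * s * C < degree E v}"
  have small: "card M \<le> s" if "matching E M" for M
  proof (rule ccontr)
    assume "\<not> card M \<le> s"
    then obtain N where "N \<subseteq> M" "card N = Suc s" by (metis not_less_eq_eq obtain_subset_with_card_n)
    then show False using no_matching matching_subset[OF that] by blast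
  qed
  have "matching E {}" by (simp add: matching_def)
  then obtain M where M: "matching E M" and max_M: "\<And>N. matching E N \<Longrightarrow> card N \<le> card M"
    using ex_has_greatest_nat[of "matching E" "{}" card "Suc s"] small by (auto simp: less_Suc_eq_le)
  define U where "U = \<Union>M"
  have ME: "M \<subseteq> E" using M by (simp add: matching_def)
  then have finM: "finite M" using fin(2) finite_subset by blast
  have UV: "U \<subseteq> V" using ME E by (auto simp: U_def uniform_hypergraph_def)
  then have finU: "finite U" using fin(1) finite_subset by blast
  have cU: "card U \<le> k * s"
    using card_Union_matching_le[OF E M] small[OF M] unfolding U_def by (meson le_trans mult_le_mono2)
  have cover: "e \<inter> U \<noteq> {}" if e: "e \<in> E" for e
  proof
    assume disj: "e \<inter> U = {}"
    have "e \<noteq> {}" using e E k by (auto simp: uniform_hypergraph_def)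
    then have "e \<notin> M" using disj by (auto simp: U_def)
    then have "card (insert e M) = Suc (card M)" using finM by simp
    moreover have "matching E (insert e M)" using matching_insert[OF M e] disj by (simp add: U_def)
    ultimately show False using max_M by fastforce
  qed
  have "E = (\<Union>v\<in>U. {e \<in> E. v \<in> e})" using cover by blast
  then have "card E \<le> (\<Sum>v\<in>U. degree E v)"
    unfolding degree_def using card_UN_le[OF finU, of "\<lambda>v. {e \<in> E. v \<in> e}"] by simp
  also have "\<dots> \<le> (\<Sum>v\<in>U. 2 * s * C + (if v \<in> A then (k - 2) * s * C else 0))"
  proof (rule sum_mono)
    fix v assume v: "v \<in> U"
    have "k = 2 + (k - 2)" using k by simp
    then have "k * s * C = 2 * s * C + (k - 2) * s * C" by (metis distrib_right)
    then show "degree E v \<le> 2 * s * C + (if v \<in> A then (k - 2) * s * C else 0)"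
      using max[of v] v UV by (auto simp: A_def)
  qed
  also have "\<dots> = card U * (2 * s * C) + card (U \<inter> A) * ((k - 2) * s * C)"
    using finU by (simp add: sum.distrib sum.If_cases)
  also have "\<dots> \<le> (k * s) * (2 * s * C) + s * ((k - 2) * s * C)"
  proof (intro add_mono mult_le_mono1)
    have "finite A" using fin(1) by (simp add: A_def)
    then have "card (U \<inter> A) \<le> card A" by (simp add: card_mono)
    then show "card (U \<inter> A) \<le> s" using few by (simp add: A_def)
  qed (rule cU)
  also have "\<dots> = (2 * k + (k - 2)) * s^2 * C" by (simp add: algebra_simps power2_eq_square)
  also have "2 * k + (k - 2) = 3 * k - 2" using k by simp
  finally show ?thesis .
qed

lemma matching_if_large_min_degree:
  fixes V :: "'a set"
  assumes "uniform_hypergraph k V E" and "2 \<le> k" and "3 * k^2 * s \<le> card V"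
    and "\<And>v. v \<in> V \<Longrightarrow>
      (card V - 1) choose (k - 1) < degree E v + ((card V - s) choose (k - 1))"
  shows "\<exists>M. matching E M \<and> card M = s"
  using assms
proof (induction s arbitrary: V E)
  case 0
  have "matching E {} \<and> card ({} :: 'a set set) = 0" by (simp add: matching_def)
  then show ?case by blast
next
  case (Suc s)
  note E = Suc.prems(1) and k = Suc.prems(2)
  note fin = uniform_hypergraph_finite[OF E]
  define n where "n = card V"
  define C where "C = (n - 2) choose (k - 2)"
  have deg: "(n - 1) choose (k - 1) < degree E v + ((n - 1 - s) choose (k - 1))" if "v \<in> V" for v
    using Suc.prems(4)[OF that] by (simp add: n_def)
  have "2 * 2 \<le> k * k" using k by (intro mult_le_mono)
  then have kk: "4 \<le> k^2" by (simp add: power2_eq_square)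
  have n: "3 * k^2 * Suc s \<le> n" using Suc.prems(3) by (simp add: n_def)
  then have n': "3 * k^2 * s + 12 \<le> n" using kk by simp
  show ?case
  proof (cases "\<exists>v\<in>V. k * s * C < degree E v")
    case True
    then obtain v where v: "v \<in> V" "k * s * C < degree E v" by blast
    let ?E = "deletion v E"
    have cV: "card (V - {v}) = n - 1" using v fin(1) by (simp add: n_def)
    \<comment> \<open>Deleting \<open>v\<close> lowers each degree by at most \<open>C\<close>, and the required degree by exactly \<open>C\<close>.\<close>
    have "\<exists>M. matching ?E M \<and> card M = s"
    proof (rule Suc.IH[OF uniform_hypergraph_deletion[OF E] k])
      show "3 * k^2 * s \<le> card (V - {v})" using n' cV by simp
      fix u assume u: "u \<in> V - {v}"
      have "{e \<in> E. u \<in> e} = {e \<in> ?E. u \<in> e} \<union> {e \<in> E. u \<in> e \<and> v \<in> e}"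
        by (auto simp: deletion_def)
      then have "degree E u \<le> degree ?E u + card {e \<in> E. u \<in> e \<and> v \<in> e}"
        using card_Un_le[of "{e \<in> ?E. u \<in> e}" "{e \<in> E. u \<in> e \<and> v \<in> e}"]
        by (simp add: degree_def)
      moreover have "card {e \<in> E. u \<in> e \<and> v \<in> e} \<le> C"
        using codegree_le[OF E, of v u] u by (auto simp add: C_def n_def)
      moreover have "(n - 1) choose (k - 1) = C + ((n - 2) choose (k - 1))"
      proof -
        have "n - 1 = Suc (n - 2)" "k - 1 = Suc (k - 2)" using n' k by auto
        then show ?thesis by (simp add: C_def)
      qed
      ultimately have "(n - 2) choose (k - 1) < degree ?E u + ((n - 1 - s) choose (k - 1))"
        using deg[of u] u by simp
      moreover have "n - 1 - 1 = n - 2" by simp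
      ultimately show "(card (V - {v}) - 1) choose (k - 1)
          < degree ?E u + ((card (V - {v}) - s) choose (k - 1))"
        by (simp only: cV)
    qed
    then obtain M where M: "matching ?E M" "card M = s" by blast
    have ME: "matching E M" and vM: "v \<notin> \<Union>M"
      using M(1) unfolding matching_def deletion_def by blast+
    have ME': "M \<subseteq> E" using ME by (simp add: matching_def)
    then have finM: "finite M" using fin(2) finite_subset by blast
    have finU: "finite (\<Union>M)" using ME' finM fin(3) by blast
    have "card {e \<in> E. v \<in> e \<and> e \<inter> \<Union>M \<noteq> {}} \<le> card (\<Union>M) * C"
      using card_edges_meeting_le[OF E finU vM] by (simp add: C_def n_def)
    also have "\<dots> \<le> k * s * C"
      using card_Union_matching_le[OF E ME] M(2) by (intro mult_le_mono1) simp
    also have "\<dots> < card {e \<in> E. v \<in> e}" using v(2) by (simp add: degree_def)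
    finally have less: "card {e \<in> E. v \<in> e \<and> e \<inter> \<Union>M \<noteq> {}} < card {e \<in> E. v \<in> e}" .
    obtain e where e: "e \<in> E" "v \<in> e" "e \<inter> \<Union>M = {}"
    proof (rule ccontr)
      assume "\<not> thesis"
      then have "{e \<in> E. v \<in> e} \<subseteq> {e \<in> E. v \<in> e \<and> e \<inter> \<Union>M \<noteq> {}}" using that by blast
      then have "card {e \<in> E. v \<in> e} \<le> card {e \<in> E. v \<in> e \<and> e \<inter> \<Union>M \<noteq> {}}"
        by (rule card_mono[rotated]) (simp add: fin(2))
      then show False using less by linarith
    qed
    have "e \<notin> M" using e(2) vM by blast
    then have "card (insert e M) = Suc s" using finM M(2) by simp
    then show ?thesis using matching_insert[OF ME e(1,3)] by blast
  next
    case False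
    then have max: "degree E v \<le> k * s * C" if "v \<in> V" for v using that by (simp add: not_less)
    have "V \<noteq> {}" using n' by (auto simp: n_def)
    then obtain v where "v \<in> V" by blast
    have s: "1 \<le> s"
    proof (rule ccontr)
      assume "\<not> 1 \<le> s"
      then have "s = 0" by simp
      then show False using max[OF \<open>v \<in> V\<close>] deg[OF \<open>v \<in> V\<close>] by simp
    qed
    show ?thesis
    proof (rule ccontr)
      assume no: "\<not> ?thesis"
      have few: "card {v \<in> V. 2 * s * C < degree E v} \<le> s"
      proof (rule ccontr)
        assume "\<not> ?thesis"
        then have "Suc s \<le> card {v \<in> V. 2 * s * C < degree E v}" by (simp only: not_less_eq_eq)
        then obtain S where S: "S \<subseteq> {v \<in> V. 2 * s * C < degree E v}" "card S = Suc s"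
          by (rule obtain_subset_with_card_n)
        have "\<exists>M. matching E M \<and> card M = card S"
        proof (rule matching_if_many_large_degrees[OF E k])
          show "S \<subseteq> V" using S(1) by blast
          have "k * Suc s \<le> 3 * k^2 * Suc s"
            by (intro mult_le_mono1) (simp add: power2_eq_square)
          then show "k * card S \<le> card V" using n unfolding S(2) n_def by (rule le_trans)
          show "2 * (card S - 1) * ((card V - 2) choose (k - 2)) < degree E v" if "v \<in> S" for v
          proof -
            have "2 * s * C < degree E v" using S(1) that by blast
            then show ?thesis using S(2) by (simp add: C_def n_def)
          qed
        qed
        then show False using no S(2) by simp
      qed
      have "k * card E \<le> k * ((3 * k - 2) * s^2 * C)"
        using card_edges_le_of_few_large_degrees[OF E k max few no] by (rule mult_le_mono2)
      then have "(\<Sum>v\<in>V. degree E v) \<le> k * (3 * k - 2) * s^2 * C"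
        by (simp only: sum_degree[OF E] mult.assoc)
      moreover have "(\<Sum>v\<in>V. (n - 1) choose (k - 1))
          < (\<Sum>v\<in>V. degree E v + ((n - 1 - s) choose (k - 1)))"
        using fin(1) \<open>V \<noteq> {}\<close> deg by (intro sum_strict_mono) auto
      then have "n * ((n - 1) choose (k - 1))
          < (\<Sum>v\<in>V. degree E v) + n * ((n - 1 - s) choose (k - 1))"
        by (simp add: sum.distrib n_def)
      ultimately show False
        using degree_condition_estimate[OF k s n] by (simp add: C_def)
    qed
  qed
qed

text \<open>
  Codegrees, on which the induction rests, carry no information for \<open>k = 1\<close>; but then all degrees are
  positive, so that every singleton is an edge.
\<close>
theorem theorem1p4:
  fixes n k s :: nat and V :: "'a set" and E :: "'a set set"
  assumes "n > 0" and "k > 0" and "s > 0"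
    and "n \<ge> 3 * k^2 * s"
    and "uniform_hypergraph k V E" and "card V = n"
    and "\<And>v. v \<in> V \<Longrightarrow>
      int (degree E v) > int ((n - 1) choose (k - 1)) - int ((n - s) choose (k - 1))"
  shows "\<exists>M. matching E M \<and> card M = s"
proof (cases "k = 1")
  case True
  have "{v} \<in> E" if v: "v \<in> V" for v
  proof -
    have "degree E v > 0" using assms(7)[OF v] True by simp
    then obtain e where e: "e \<in> E" "v \<in> e"
      unfolding degree_def by (metis (mono_tags, lifting) card_gt_0_iff ex_in_conv mem_Collect_eq)
    then have "card e = 1" using assms(5) True by (simp add: uniform_hypergraph_def)
    then have "e = {v}" using e(2) by (auto simp: card_1_singleton_iff)
    then show ?thesis using e(1) by simp
  qed
  moreover have "s \<le> card V" using assms(4,6) True by simp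
  then obtain S where S: "S \<subseteq> V" "card S = s" by (metis obtain_subset_with_card_n)
  ultimately have "matching E ((\<lambda>v. {v}) ` S)" by (auto simp: matching_def disjoint_def)
  moreover have "card ((\<lambda>v. {v}) ` S) = s" using S(2) by (simp add: card_image)
  ultimately show ?thesis by blast
next
  case False
  show ?thesis
  proof (rule matching_if_large_min_degree[OF assms(5)])
    show "2 \<le> k" using False assms(2) by simp
    show "3 * k^2 * s \<le> card V" using assms(4,6) by simp
    show "(card V - 1) choose (k - 1) < degree E v + ((card V - s) choose (k - 1))" if "v \<in> V" for v
      using assms(7)[OF that] unfolding assms(6) by linarith
  qed
qed

end
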